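(* Let the problem data $f^{(1)},f^{(2)},g^{(1)},g^{(2)}$ satisfy the Basic Assumption, and consider the proximal gradient iterations $x_{k+1}=\operatorname{prox}_{\alpha_{k+1}g_{k+1}}(x_k-\alpha_{k+1}\nabla f_{k+1}(x_k))$ (see context), with stepsizes $\alpha_{k+1}>0$ and $0<\sigma_{k+1}\le\sigma_k$. Let $\bar\varphi^{(2)}:=\varphi^{(2)}-\bar\phi^{(2)}\ge0$, and define $\Delta_k:=\frac1{\sigma_k}-\frac1{\sigma_{k-1}}$, $\rho_{k+1}:=\frac{\sigma_{k+1}\alpha_{k+1}}{\sigma_k\alpha_k}$, and $$\mathcal L_k(x_\star):=\tfrac12\|x_k-x_\star\|^2+W_k$$ with $$W_k:=\tfrac{1-4\alpha_k\sigma_k\ell_k^{(2)}\Delta_k}{4}\|x_k-x_{k-1}\|^2+\tfrac{\sigma_{k+1}}{\sigma_k}\alpha_{k+1}\rho_{k+1}\bar\varphi^{(2)}(x_{k-1})+\sigma_k\alpha_k\Delta_k\bar\varphi^{(2)}(x_k)+\sigma_k\alpha_k(1+\rho_k)\bigl(\varphi^{(1)}(x_{k-1})-\phi_\star\bigr).$$ Then, for every $k\in\mathbb N$ and $x_\star\in\mathcal X_\star$ it holds that $$\begin{aligned}\mathcal L_{k+1}(x_\star)-\mathcal L_k(x_\star)\le{}&-\Bigl(\tfrac14+\rho_{k+1}^2(\alpha_k\ell_k-\alpha_k^2L_k^2)-\sigma_k\alpha_k\ell_k^{(2)}\Delta_k\Bigr)\|x_{k-1}-x_k\|^2\\&-\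sigma_k\alpha_k\bigl(1+\rho_k-\rho_{k+1}^2\bigr)\bigl(\varphi^{(1)}(x_{k-1})-\phi_\star\bigr)\\&-\sigma_{k+1}\alpha_{k+1}\Bigl(\tfrac{\Delta_k}{\rho_{k+1}}+\tfrac1{\sigma_k}\bigl(1+\rho_{k+1}-\rho_{k+2}^2\tfrac{\sigma_k}{\sigma_{k+1}}\bigr)\Bigr)\bar\varphi^{(2)}(x_k).\end{aligned}$$
   Context: Bilevel problem: minimize $\varphi^{(1)}(x)=f^{(1)}(x)+g^{(1)}(x)$ over $x\in\mathcal X^{(2)}=\operatorname{argmin}_{w\in\mathbb R^n}\varphi^{(2)}(w)$, where $\varphi^{(2)}=f^{(2)}+g^{(2)}$. Basic Assumption: (1) $f^{(1)},f^{(2)}:\mathbb R^n\to\mathbb R$ are convex and have locally Lipschitz-continuous gradients; (2) $g^{(1)},g^{(2)}:\mathbb R^n\to\mathbb R\cup\{\infty\}$ are proper, lower semicontinuous and convex, with easy to compute proximal mappings; (3) $\bar\phi^{(1)}:=\inf_{x\in\operatorname{dom}\varphi^{(2)}}\varphi^{(1)}(x)>-\infty$; (4) the solution set $\mathcal X_\star:=\operatorname{argmin}\{\varphi^{(1)}(x): x\in\mathcal X^{(2)}\}$ is nonempty and bounded; in particular $\bar\phi^{(2)}:=\inf_{\mathbb R^n}\varphi^{(2)}>-\infty$. The optimal cost is $\phi_\star:=\inf_{\mathcal X^{(2)}}\varphi^{(1)}$. Iterations: $(\sigma_k)_{k\ge-1}$ and $(\alpha_k)_{k\ge-1}$ are strictly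 positive, with $\sigma_{k+1}\le\sigma_k$; $f_k=\sigma_kf^{(1)}+f^{(2)}$, $g_k=\sigma_kg^{(1)}+g^{(2)}$; starting from $x_{-1}\in\mathbb R^n$, $x_{k+1}=\operatorname{prox}_{\alpha_{k+1}g_{k+1}}(x_k-\alpha_{k+1}\nabla f_{k+1}(x_k))$ for $k\ge-1$. Notation: $\operatorname{dom}h=\{x:h(x)<\infty\}$, $\operatorname{prox}_h(x)=\operatorname{argmin}_w\{h(w)+\tfrac12\|w-x\|^2\}$, $0\in\mathbb N$. With the convention $0/0=0$, $$\ell_k=\frac{\langle\nabla f_k(x_{k-1})-\nabla f_k(x_k),x_{k-1}-x_k\rangle}{\|x_{k-1}-x_k\|^2},\quad L_k=\frac{\|\nabla f_k(x_{k-1})-\nabla f_k(x_k)\|}{\|x_{k-1}-x_k\|},\quad \ell_k^{(2)}=\frac{\langle\nabla f^{(2)}(x_{k-1})-\nabla f^{(2)}(x_k),x_{k-1}-x_k\rangle}{\|x_{k-1}-x_k\|^2}.$$ *)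

theory Defs
  imports "HOL-Analysis.Analysis"
begin

text \<open>
  Functions into R \<union> {\<infinity>} are modelled as \<open>ereal\<close>-valued functions that never take the
  value \<open>-\<infinity>\<close>.
\<close>

definition edom :: "('a \<Rightarrow> ereal) \<Rightarrow> 'a set" where
  "edom h = {x. h x < \<infinity>}"

definition proper :: "('a \<Rightarrow> ereal) \<Rightarrow> bool" where
  "proper h \<longleftrightarrow> (\<forall>x. h x \<noteq> -\<infinity>) \<and> edom h \<noteq> {}"

definition lsc :: "('a::topological_space \<Rightarrow> ereal) \<Rightarrow> bool" where
  "lsc h \<longleftrightarrow> (\<forall>x. h x \<le> Liminf (at x) h)"

text \<open>
  The library's \<^const>\<open>convex_on\<close> covers only real-valued functions.  For functions that are never
  \<open>-\<infinity>\<close> the right-hand side below contains no undetermined form; at the end points it relies on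
  \<open>0 * \<infinity> = 0\<close>, which holds in \<open>ereal\<close>.
\<close>
definition econvex :: "('a::real_vector \<Rightarrow> ereal) \<Rightarrow> bool" where
  "econvex h \<longleftrightarrow> (\<forall>x y. \<forall>u\<ge>0. \<forall>v\<ge>0. u + v = 1 \<longrightarrow>
     h (u *\<^sub>R x + v *\<^sub>R y) \<le> ereal u * h x + ereal v * h y)"

text \<open>
  Usual convention of variational analysis: a point of infinite value is not a minimizer, so
  that the set of minimizers is empty if \<open>h\<close> is identically \<open>\<infinity>\<close> on \<open>S\<close>.
\<close>
definition argmin_on :: "('a \<Rightarrow> ereal) \<Rightarrow> 'a set \<Rightarrow> 'a set" where
  "argmin_on h S = {x. is_arg_min h (\<lambda>y. y \<in> S) x \<and> h x < \<infinity>}"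

text \<open>
  Set-valued; a singleton whenever \<open>h\<close> is proper, lower semicontinuous and convex on
  a Euclidean space.
\<close>
definition prox :: "('a::real_normed_vector \<Rightarrow> ereal) \<Rightarrow> 'a \<Rightarrow> 'a set" where
  "prox h x = argmin_on (\<lambda>w. h w + ereal (1/2 * (norm (w - x))\<^sup>2)) UNIV"

text \<open>Meaningful only where \<open>f\<close> is differentiable.\<close>
definition grad :: "('a::real_inner \<Rightarrow> real) \<Rightarrow> 'a \<Rightarrow> 'a" where
  "grad f x = (THE D. GDERIV f x :> D)"

definition locally_Lipschitz_grad :: "('a::real_inner \<Rightarrow> real) \<Rightarrow> bool" where
  "locally_Lipschitz_grad f \<longleftrightarrow>
     (\<forall>x. \<exists>D. GDERIV f x :> D) \<and>
     (\<forall>x. \<exists>r>0. \<exists>L. L-lipschitz_on (cball x r) (grad f))"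

definition cost :: "('a \<Rightarrow> real) \<Rightarrow> ('a \<Rightarrow> ereal) \<Rightarrow> 'a \<Rightarrow> ereal" where
  "cost f g x = ereal (f x) + g x"

definition lower_sols :: "('a \<Rightarrow> real) \<Rightarrow> ('a \<Rightarrow> ereal) \<Rightarrow> 'a set" where
  "lower_sols f2 g2 = argmin_on (cost f2 g2) UNIV"

definition bilevel_sols ::
    "('a \<Rightarrow> real) \<Rightarrow> ('a \<Rightarrow> real) \<Rightarrow> ('a \<Rightarrow> ereal) \<Rightarrow> ('a \<Rightarrow> ereal) \<Rightarrow> 'a set" where
  "bilevel_sols f1 f2 g1 g2 = argmin_on (cost f1 g1) (lower_sols f2 g2)"

text \<open>
  That \<open>cost f2 g2\<close> is bounded below follows from \<open>bilevel_sols f1 f2 g1 g2 \<noteq> {}\<close>: its minimum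
  is attained.
\<close>
definition basic_assumption ::
    "('a::euclidean_space \<Rightarrow> real) \<Rightarrow> ('a \<Rightarrow> real) \<Rightarrow> ('a \<Rightarrow> ereal) \<Rightarrow> ('a \<Rightarrow> ereal) \<Rightarrow> bool" where
  "basic_assumption f1 f2 g1 g2 \<longleftrightarrow>
     convex_on UNIV f1 \<and> locally_Lipschitz_grad f1 \<and>
     convex_on UNIV f2 \<and> locally_Lipschitz_grad f2 \<and>
     proper g1 \<and> lsc g1 \<and> econvex g1 \<and>
     proper g2 \<and> lsc g2 \<and> econvex g2 \<and>
     (INF x\<in>edom (cost f2 g2). cost f1 g1 x) > -\<infinity> \<and>
     bilevel_sols f1 f2 g1 g2 \<noteq> {} \<and> bounded (bilevel_sols f1 f2 g1 g2)"

definition f_comb :: "('a \<Rightarrow> real) \<Rightarrow> ('a \<Rightarrow> real) \<Rightarrow> real \<Rightarrow> 'a \<Rightarrow> real" where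
  "f_comb f1 f2 s x = s * f1 x + f2 x"

definition g_comb :: "('a \<Rightarrow> ereal) \<Rightarrow> ('a \<Rightarrow> ereal) \<Rightarrow> real \<Rightarrow> 'a \<Rightarrow> ereal" where
  "g_comb g1 g2 s x = ereal s * g1 x + g2 x"

text \<open>
  The sequences are indexed by the integers \<open>\<ge> -1\<close>; their values at smaller indices are irrelevant.
\<close>
definition prox_grad_iterates ::
    "('a::euclidean_space \<Rightarrow> real) \<Rightarrow> ('a \<Rightarrow> real) \<Rightarrow> ('a \<Rightarrow> ereal) \<Rightarrow> ('a \<Rightarrow> ereal) \<Rightarrow>
     (int \<Rightarrow> real) \<Rightarrow> (int \<Rightarrow> real) \<Rightarrow> (int \<Rightarrow> 'a) \<Rightarrow> bool" where
  "prox_grad_iterates f1 f2 g1 g2 \<sigma> \<alpha> x \<longleftrightarrow>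
     (\<forall>k\<ge>-1. 0 < \<sigma> k \<and> 0 < \<alpha> k \<and> \<sigma> (k+1) \<le> \<sigma> k) \<and>
     (\<forall>k\<ge>-1. x (k+1) \<in>
        prox (\<lambda>w. ereal (\<alpha> (k+1)) * g_comb g1 g2 (\<sigma> (k+1)) w)
             (x k - \<alpha> (k+1) *\<^sub>R grad (f_comb f1 f2 (\<sigma> (k+1))) (x k)))"

text \<open>
  Local curvature and Lipschitz estimates of \<open>grad f\<close> between two points; \<open>0 / 0 = 0\<close> is built
  into division on the reals.
\<close>
definition curv_est :: "('a::real_inner \<Rightarrow> real) \<Rightarrow> 'a \<Rightarrow> 'a \<Rightarrow> real" where
  "curv_est f u v = inner (grad f u - grad f v) (u - v) / (norm (u - v))\<^sup>2"

definition Lip_est :: "('a::real_inner \<Rightarrow> real) \<Rightarrow> 'a \<Rightarrow> 'a \<Rightarrow> real" where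
  "Lip_est f u v = norm (grad f u - grad f v) / norm (u - v)"

end

theory Submission
  imports Defs
begin

text \<open>
  Put \<open>\<tau>\<^sub>k = \<sigma>\<^sub>k \<alpha>\<^sub>k\<close>.  The \<open>k\<close>-th iteration is a proximal gradient step of length \<open>\<tau>\<^sub>k\<close> on
  \<open>\<phi>\<^sup>1 + \<phi>\<^sup>2 / \<sigma>\<^sub>k\<close>, and \<open>\<rho>\<^sub>k = \<tau>\<^sub>k / \<tau>\<^sub>k\<^sub>-\<^sub>1\<close> is the ratio of consecutive step lengths.
  The inequality is the descent inequality of adaptive proximal gradient methods for these steps,
  corrected for the change of the objective by \<open>\<Delta>\<^sub>k\<^sub>+\<^sub>1 \<phi>\<^sup>2\<close> from one step to the next.

  Optimality of \<open>x\<^sub>k\<^sub>+\<^sub>1\<close> gives a subgradient of \<open>g\<^sub>k\<^sub>+\<^sub>1\<close> there (\<open>prox_subgradient\<close>).  Evaluated at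
  \<open>x\<^sub>\<star>\<close>, it yields the usual three-point inequality, in which the linearised increment
  \<open>g\<^sub>k\<^sub>+\<^sub>1(x\<^sub>k\<^sub>+\<^sub>1) - g\<^sub>k\<^sub>+\<^sub>1(x\<^sub>k) + \<langle>\<nabla>f\<^sub>k\<^sub>+\<^sub>1(x\<^sub>k), x\<^sub>k\<^sub>+\<^sub>1 - x\<^sub>k\<rangle>\<close> is left over and must be bounded from
  below.  A merely locally Lipschitz gradient gives no constant for a descent lemma, so the previous
  step is used instead: the vector
  \<open>e = x\<^sub>k\<^sub>-\<^sub>1 - x\<^sub>k - \<alpha>\<^sub>k (\<nabla>f\<^sub>k(x\<^sub>k\<^sub>-\<^sub>1) - \<nabla>f\<^sub>k(x\<^sub>k))\<close>
  is \<open>\<alpha>\<^sub>k\<close> times a subgradient of \<open>\<phi>\<^sub>k\<close> at \<open>x\<^sub>k\<close>.  Towards \<open>x\<^sub>k\<^sub>+\<^sub>1\<close>, it bounds the part of the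
  increment that belongs to the old weight \<open>1 / \<sigma>\<^sub>k\<close>, up to \<open>\<rho>\<^sub>k\<^sub>+\<^sub>1\<^sup>2 \<parallel>e\<parallel>\<^sup>2 + \<parallel>x\<^sub>k\<^sub>+\<^sub>1 - x\<^sub>k\<parallel>\<^sup>2 / 4\<close> by Young's inequality;
  the norm of \<open>e\<close> is expressed by \<open>\<ell>\<^sub>k\<close> and \<open>L\<^sub>k\<close> (\<open>forward_residual_norm\<close>), and \<open>e\<close> towards \<open>x\<^sub>k\<^sub>-\<^sub>1\<close>
  trades a part of \<open>\<parallel>e\<parallel>\<^sup>2\<close> for the function values at \<open>x\<^sub>k\<^sub>-\<^sub>1\<close>.  The remaining part of the increment
  is a nonnegative multiple of the linearised increment for \<open>f\<^sup>2\<close> and \<open>g\<^sup>2\<close>, which convexity of \<open>f\<^sup>2\<close> bounds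
  by \<open>\<phi>\<^sup>2(x\<^sub>k\<^sub>+\<^sub>1) - \<phi>\<^sup>2(x\<^sub>k) - \<ell>\<^sup>2\<^sub>k\<^sub>+\<^sub>1 \<parallel>x\<^sub>k\<^sub>+\<^sub>1 - x\<^sub>k\<parallel>\<^sup>2\<close>.  This is \<open>prox_grad_step_estimate\<close>; the
  theorem follows from it by comparing coefficients.

  Only \<open>x\<^sub>-\<^sub>1\<close> may lie outside the domains.  Then \<open>\<L>\<^sub>0 = \<infinity>\<close> while \<open>\<L>\<^sub>1\<close> is finite, so the left-hand
  side for \<open>k = 0\<close> is \<open>-\<infinity>\<close>.
\<close>

section \<open>Extended-valued convex functions and proximal points\<close>

lemma econvex_add:
  assumes "econvex h" "econvex g"
  shows "econvex (\<lambda>x. h x + g x)"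
  unfolding econvex_def
proof (intro allI impI)
  fix x y :: 'a and u v :: real
  assume uv: "0 \<le> u" "0 \<le> v" "u + v = 1"
  have "h (u *\<^sub>R x + v *\<^sub>R y) + g (u *\<^sub>R x + v *\<^sub>R y)
      \<le> (ereal u * h x + ereal v * h y) + (ereal u * g x + ereal v * g y)"
    using assms uv unfolding econvex_def by (intro add_mono) blast+
  also have "\<dots> = ereal u * (h x + g x) + ereal v * (h y + g y)"
    using uv by (simp add: ereal_pos_distrib ac_simps)
  finally show "h (u *\<^sub>R x + v *\<^sub>R y) + g (u *\<^sub>R x + v *\<^sub>R y)
      \<le> ereal u * (h x + g x) + ereal v * (h y + g y)" .
qed

lemma econvex_scale:
  assumes "econvex h" "0 \<le> c"
  shows "econvex (\<lambda>x. ereal c * h x)"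
  unfolding econvex_def
proof (intro allI impI)
  fix x y :: 'a and u v :: real
  assume uv: "0 \<le> u" "0 \<le> v" "u + v = 1"
  have "ereal c * h (u *\<^sub>R x + v *\<^sub>R y) \<le> ereal c * (ereal u * h x + ereal v * h y)"
    using assms uv unfolding econvex_def by (intro ereal_mult_left_mono) auto
  also have "\<dots> = ereal u * (ereal c * h x) + ereal v * (ereal c * h y)"
    using assms(2) by (simp add: ereal_pos_distrib mult.left_commute)
  finally show "ereal c * h (u *\<^sub>R x + v *\<^sub>R y)
      \<le> ereal u * (ereal c * h x) + ereal v * (ereal c * h y)" .
qed

text \<open>
  The residual \<open>y - p\<close> of a proximal point \<open>p\<close> is a subgradient there.  Comparing \<open>p\<close> with the
  points \<open>p + t (z - p)\<close> and dividing by \<open>t\<close>, the quadratic term contributes only its linear part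
  as \<open>t\<close> tends to \<open>0\<close>.
\<close>
lemma prox_subgradient:
  fixes h :: "'a::real_inner \<Rightarrow> ereal"
  assumes cvx: "econvex h" and nm: "\<And>x. h x \<noteq> -\<infinity>" and p: "p \<in> prox h y"
  shows "h p + ereal (inner (y - p) (z - p)) \<le> h z"
proof (cases "h z")
  case (real hz)
  from p have "h p + ereal (1/2 * (norm (p - y))\<^sup>2) < \<infinity>"
    by (simp add: prox_def argmin_on_def)
  then obtain hp where hp: "h p = ereal hp"
    using nm[of p] by (cases "h p") auto
  have step: "hp - hz \<le> inner (p - y) (z - p) + t * (1/2 * (norm (z - p))\<^sup>2)"
    if t: "0 < t" "t \<le> 1" for t
  proof -
    define w where "w = (1 - t) *\<^sub>R p + t *\<^sub>R z"
    have w: "w - y = (p - y) + t *\<^sub>R (z - p)"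
      by (simp add: w_def algebra_simps)
    have "h w \<le> ereal (1 - t) * h p + ereal t * h z"
      using cvx t unfolding econvex_def w_def by simp
    then have "h w \<le> ereal ((1 - t) * hp + t * hz)"
      by (simp add: hp real)
    moreover have "h p + ereal (1/2 * (norm (p - y))\<^sup>2) \<le> h w + ereal (1/2 * (norm (w - y))\<^sup>2)"
      using p by (auto simp: prox_def argmin_on_def is_arg_min_def not_less)
    ultimately have "hp + 1/2 * (norm (p - y))\<^sup>2
        \<le> (1 - t) * hp + t * hz + 1/2 * (norm (w - y))\<^sup>2"
      using nm[of w] by (cases "h w") (auto simp: hp)
    moreover have "(norm (w - y))\<^sup>2
        = (norm (p - y))\<^sup>2 + t * (2 * inner (p - y) (z - p) + t * (norm (z - p))\<^sup>2)"
      unfolding w by (simp only: power2_norm_eq_inner) (simp add: inner_simps inner_commute field_simps)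
    ultimately have "t * (hp - hz) \<le> t * (inner (p - y) (z - p) + t * (1/2 * (norm (z - p))\<^sup>2))"
      by (simp add: algebra_simps)
    then show ?thesis using t by simp
  qed
  have "((\<lambda>t. inner (p - y) (z - p) + t * (1/2 * (norm (z - p))\<^sup>2)) \<longlongrightarrow>
      inner (p - y) (z - p) + 0 * (1/2 * (norm (z - p))\<^sup>2)) (at_right 0)"
    by (intro tendsto_intros)
  moreover have "\<forall>\<^sub>F t in at_right 0. hp - hz \<le> inner (p - y) (z - p) + t * (1/2 * (norm (z - p))\<^sup>2)"
    unfolding eventually_at_right_field by (rule exI[of _ 1]) (use step in auto)
  ultimately have "hp - hz \<le> inner (p - y) (z - p) + 0 * (1/2 * (norm (z - p))\<^sup>2)"
    by (rule tendsto_lowerbound) simp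
  then have "hp + inner (y - p) (z - p) \<le> hz"
    by (simp add: inner_diff_left)
  then show ?thesis by (simp add: hp real)
qed (use nm in auto)

lemma argmin_on_INF:
  assumes "v \<in> argmin_on h S"
  shows "v \<in> S" "h v < \<infinity>" "(INF z\<in>S. h z) = h v"
proof -
  from assms show v: "v \<in> S" "h v < \<infinity>"
    by (auto simp: argmin_on_def is_arg_min_def)
  from assms show "(INF z\<in>S. h z) = h v"
    by (intro antisym INF_lower INF_greatest v)
       (auto simp: argmin_on_def is_arg_min_def not_less)
qed

text \<open>
  The minimized function is finite at \<open>p\<close>, so \<open>p\<close> lies in both domains; on their intersection
  the subgradient inequality is one between real numbers.
\<close>
lemma prox_g_comb_subgradient:
  fixes g1 g2 :: "'a::real_inner \<Rightarrow> ereal"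
  assumes g1: "econvex g1" "\<And>w. g1 w \<noteq> -\<infinity>" and g2: "econvex g2" "\<And>w. g2 w \<noteq> -\<infinity>"
    and pos: "0 < a" "0 < s"
    and p: "p \<in> prox (\<lambda>w. ereal a * g_comb g1 g2 s w) y"
  shows "p \<in> edom g1 \<inter> edom g2"
    and "z \<in> edom g1 \<inter> edom g2 \<Longrightarrow> inner (y - p) (z - p)
      \<le> a * (s * (real_of_ereal (g1 z) - real_of_ereal (g1 p))
             + (real_of_ereal (g2 z) - real_of_ereal (g2 p)))"
proof -
  let ?h = "\<lambda>w. ereal a * g_comb g1 g2 s w"
  have s1: "ereal s * g1 w \<noteq> -\<infinity>" for w
    using g1(2)[of w] pos by (cases "g1 w") auto
  have comb: "g_comb g1 g2 s w \<noteq> -\<infinity>" for w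
    using s1[of w] g2(2)[of w] by (auto simp: g_comb_def)
  have nm: "?h w \<noteq> -\<infinity>" for w
    using comb[of w] pos by (cases "g_comb g1 g2 s w") auto
  have "econvex (g_comb g1 g2 s)"
    using econvex_add[OF econvex_scale[OF g1(1), of s] g2(1)] pos
    by (simp add: g_comb_def[abs_def])
  then have cvx: "econvex ?h"
    using pos(1) by (intro econvex_scale) auto
  have "?h p < \<infinity>"
    using p by (auto simp: prox_def argmin_on_def)
  then show dom: "p \<in> edom g1 \<inter> edom g2"
    using g1(2)[of p] g2(2)[of p] pos
    by (cases "g1 p"; cases "g2 p") (auto simp: g_comb_def edom_def)
  assume z: "z \<in> edom g1 \<inter> edom g2"
  have "?h p + ereal (inner (y - p) (z - p)) \<le> ?h z"
    by (rule prox_subgradient[OF cvx nm p])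
  with z dom show "inner (y - p) (z - p)
      \<le> a * (s * (real_of_ereal (g1 z) - real_of_ereal (g1 p))
             + (real_of_ereal (g2 z) - real_of_ereal (g2 p)))"
    using g1(2)[of p] g2(2)[of p] g1(2)[of z] g2(2)[of z]
    by (cases "g1 p"; cases "g2 p"; cases "g1 z"; cases "g2 z")
       (auto simp: g_comb_def edom_def algebra_simps)
qed

section \<open>Gradients of convex functions\<close>

lemma grad_eq:
  assumes "GDERIV f x :> D"
  shows "grad f x = D"
  unfolding grad_def
proof (rule the_equality, rule assms)
  fix E assume "GDERIV f x :> E"
  then have "(\<lambda>h. inner h E) = (\<lambda>h. inner h D)"
    using assms has_derivative_unique unfolding gderiv_def by blast
  from fun_cong[OF this, of "E - D"] have "inner (E - D) (E - D) = 0"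
    by (simp add: inner_diff_right)
  then show "E = D" by simp
qed

lemma GDERIV_grad:
  assumes "locally_Lipschitz_grad f"
  shows "GDERIV f x :> grad f x"
proof -
  obtain D where "GDERIV f x :> D"
    using assms unfolding locally_Lipschitz_grad_def by blast
  then show ?thesis by (simp add: grad_eq)
qed

lemma grad_f_comb:
  assumes "locally_Lipschitz_grad f1" "locally_Lipschitz_grad f2"
  shows "grad (f_comb f1 f2 s) x = s *\<^sub>R grad f1 x + grad f2 x"
proof (rule grad_eq)
  show "GDERIV (f_comb f1 f2 s) x :> s *\<^sub>R grad f1 x + grad f2 x"
    using GDERIV_grad[OF assms(1), of x] GDERIV_grad[OF assms(2), of x]
    unfolding gderiv_def f_comb_def
    by (auto intro!: derivative_eq_intros simp: inner_simps fun_eq_iff)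
qed

text \<open>
  This reduces to the one-dimensional tangent inequality on the line through \<open>y\<close> and \<open>z\<close>.
\<close>
lemma convex_on_above_tangent_plane:
  assumes "convex_on UNIV f" "locally_Lipschitz_grad f"
  shows "f y + inner (grad f y) (z - y) \<le> f z"
proof -
  define \<phi> where "\<phi> = (\<lambda>t::real. f (y + t *\<^sub>R (z - y)))"
  have "convex_on UNIV \<phi>"
  proof (rule convex_onI)
    fix t a b :: real assume t: "0 < t" "t < 1"
    have "y + ((1 - t) *\<^sub>R a + t *\<^sub>R b) *\<^sub>R (z - y)
        = (1 - t) *\<^sub>R (y + a *\<^sub>R (z - y)) + t *\<^sub>R (y + b *\<^sub>R (z - y))"
      by (simp add: algebra_simps)
    then show "\<phi> ((1 - t) *\<^sub>R a + t *\<^sub>R b) \<le> (1 - t) * \<phi> a + t * \<phi> b"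
      unfolding \<phi>_def using convex_onD[OF assms(1), of t] t by auto
  qed auto
  moreover have "(\<phi> has_real_derivative inner (grad f y) (z - y)) (at 0 within UNIV)"
  proof -
    have "(f has_derivative (\<lambda>h. inner h (grad f y))) (at (y + 0 *\<^sub>R (z - y)))"
      using GDERIV_grad[OF assms(2), of y] by (simp add: gderiv_def)
    moreover have "((\<lambda>t. y + t *\<^sub>R (z - y)) has_derivative (\<lambda>t. t *\<^sub>R (z - y))) (at 0)"
      by (auto intro!: derivative_eq_intros)
    ultimately have "(\<phi> has_derivative (\<lambda>t. inner (t *\<^sub>R (z - y)) (grad f y))) (at 0)"
      unfolding \<phi>_def by (rule has_derivative_compose[rotated])
    then show ?thesis
      by (simp add: has_field_derivative_def inner_commute mult.commute[of _ "inner _ _"])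
  qed
  ultimately have "inner (grad f y) (z - y) * (1 - 0) \<le> \<phi> 1 - \<phi> 0"
    by (intro convex_on_imp_above_tangent[where A = UNIV]) auto
  then show ?thesis by (simp add: \<phi>_def)
qed

lemma curv_est_mult_norm: "curv_est f u v * (norm (u - v))\<^sup>2 = inner (grad f u - grad f v) (u - v)"
  by (simp add: curv_est_def)

lemma Lip_est_mult_norm: "(Lip_est f u v)\<^sup>2 * (norm (u - v))\<^sup>2 = (norm (grad f u - grad f v))\<^sup>2"
  by (cases "u = v") (auto simp: Lip_est_def power_divide)

text \<open>
  The cross term of the square is measured by the curvature estimate, the gradient term by the
  Lipschitz estimate; for \<open>u = v\<close> both sides vanish whatever value \<open>0 / 0\<close> has.
\<close>
lemma forward_residual_norm:
  "(norm ((u - v) - a *\<^sub>R (grad f u - grad f v)))\<^sup>2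
    = (1 - 2 * a * curv_est f u v + a\<^sup>2 * (Lip_est f u v)\<^sup>2) * (norm (u - v))\<^sup>2"
proof -
  have "(norm ((u - v) - a *\<^sub>R (grad f u - grad f v)))\<^sup>2
     = (norm (u - v))\<^sup>2 - 2 * a * inner (grad f u - grad f v) (u - v)
       + a\<^sup>2 * (norm (grad f u - grad f v))\<^sup>2"
    unfolding power2_norm_eq_inner by (simp add: inner_simps inner_commute algebra_simps power2_eq_square)
  also have "\<dots> = (norm (u - v))\<^sup>2 - 2 * a * (curv_est f u v * (norm (u - v))\<^sup>2)
       + a\<^sup>2 * ((Lip_est f u v)\<^sup>2 * (norm (u - v))\<^sup>2)"
    by (simp only: curv_est_mult_norm Lip_est_mult_norm)
  finally show ?thesis by (simp add: algebra_simps)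
qed

section \<open>One proximal gradient step\<close>

text \<open>
  Here \<open>w\<close>, \<open>y\<close>, \<open>p\<close> are three consecutive iterates and \<open>z\<close> is a point of comparison;
  \<open>\<gamma>1\<close> and \<open>\<gamma>2\<close> are the values of the nonsmooth terms on their common domain \<open>D\<close>.  The two step
  hypotheses say that \<open>y\<close> and \<open>p\<close> arise from proximal gradient steps.  The multiple
  \<open>s' a' (1/s' - 1/s)\<close> of the lower-level cost accounts for the decrease of the weight from \<open>s\<close>
  to \<open>s'\<close>.
\<close>
lemma prox_grad_step_estimate:
  fixes f1 f2 \<gamma>1 \<gamma>2 :: "'a::real_inner \<Rightarrow> real" and D :: "'a set"
    and w y p z :: 'a and a a' s s' :: real
  assumes f1: "convex_on UNIV f1" "locally_Lipschitz_grad f1"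
    and f2: "convex_on UNIV f2" "locally_Lipschitz_grad f2"
    and pos: "0 < a" "0 < a'" "0 < s" "0 < s'" and mono: "s' \<le> s"
    and y_step: "\<And>z. z \<in> D \<Longrightarrow> inner (w - a *\<^sub>R grad (f_comb f1 f2 s) w - y) (z - y)
        \<le> a * (s * (\<gamma>1 z - \<gamma>1 y) + (\<gamma>2 z - \<gamma>2 y))"
    and p_step: "\<And>z. z \<in> D \<Longrightarrow> inner (y - a' *\<^sub>R grad (f_comb f1 f2 s') y - p) (z - p)
        \<le> a' * (s' * (\<gamma>1 z - \<gamma>1 p) + (\<gamma>2 z - \<gamma>2 p))"
    and D: "w \<in> D" "p \<in> D" "z \<in> D"
  defines "\<Phi>1 \<equiv> \<lambda>v. f1 v + \<gamma>1 v" and "\<Phi>2 \<equiv> \<lambda>v. f2 v + \<gamma>2 v"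
    and "r \<equiv> (s' * a') / (s * a)"
    and "\<l> \<equiv> curv_est (f_comb f1 f2 s) w y" and "L \<equiv> Lip_est (f_comb f1 f2 s) w y"
    and "\<l>2 \<equiv> curv_est f2 y p"
  shows "1/2 * (norm (p - z))\<^sup>2 + (1/4 - s' * a' * \<l>2 * (1/s' - 1/s)) * (norm (p - y))\<^sup>2
      + s' * a' * (1/s' - 1/s) * (\<Phi>2 p - \<Phi>2 y)
      + a' * (s' * (\<Phi>1 y - \<Phi>1 z) + (\<Phi>2 y - \<Phi>2 z))
    \<le> 1/2 * (norm (y - z))\<^sup>2 - r\<^sup>2 * (a * \<l> - a\<^sup>2 * L\<^sup>2) * (norm (w - y))\<^sup>2
      + r\<^sup>2 * a * (s * (\<Phi>1 w - \<Phi>1 y) + (\<Phi>2 w - \<Phi>2 y))"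
proof -
  have G: "grad (f_comb f1 f2 t) v = t *\<^sub>R grad f1 v + grad f2 v" for t v
    by (rule grad_f_comb[OF f1(2) f2(2)])
  note tangent1 = convex_on_above_tangent_plane[OF f1]
  note tangent2 = convex_on_above_tangent_plane[OF f2]
  define e where "e = (w - y) - a *\<^sub>R (grad (f_comb f1 f2 s) w - grad (f_comb f1 f2 s) y)"
  define B1 where "B1 = \<gamma>1 p - \<gamma>1 y + inner (grad f1 y) (p - y)"
  define B2 where "B2 = \<gamma>2 p - \<gamma>2 y + inner (grad f2 y) (p - y)"
  (* The bracket that multiplies a on the right is an inner product with grad (f_comb f1 f2 s) y, so
     that convexity of f1 and f2 at y turns e into a multiple of a subgradient of the total cost. *)
  have e_y: "inner e (v - y) = inner (w - a *\<^sub>R grad (f_comb f1 f2 s) w - y) (v - y)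
      + a * (s * inner (grad f1 y) (v - y) + inner (grad f2 y) (v - y))" for v
    by (simp add: e_def G inner_add_left inner_diff_left algebra_simps)

  (* The subgradient e towards the previous point w. *)
  have backward: "(norm (w - y))\<^sup>2 * (1 - a * \<l>) \<le> a * (s * (\<Phi>1 w - \<Phi>1 y) + (\<Phi>2 w - \<Phi>2 y))"
  proof -
    have "inner e (w - y) = (norm (w - y))\<^sup>2
        - a * inner (grad (f_comb f1 f2 s) w - grad (f_comb f1 f2 s) y) (w - y)"
      unfolding e_def inner_diff_left[of "w - y"] by (simp add: power2_norm_eq_inner)
    then have "(norm (w - y))\<^sup>2 * (1 - a * \<l>) = inner e (w - y)"
      unfolding \<l>_def curv_est_mult_norm[symmetric] by (simp add: algebra_simps)
    also have "\<dots> \<le> a * (s * (\<gamma>1 w - \<gamma>1 y) + (\<gamma>2 w - \<gamma>2 y))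
        + a * (s * (f1 w - f1 y) + (f2 w - f2 y))"
      unfolding e_y using y_step[OF D(1)] tangent1[of y w] tangent2[of y w] pos
      by (intro add_mono mult_left_mono) auto
    finally show ?thesis
      by (simp add: \<Phi>1_def \<Phi>2_def algebra_simps)
  qed

  (* The subgradient e towards the next point p; the square below is Young's inequality, with
     weights chosen such that a quarter of the squared last displacement survives at the end. *)
  have forward: "- r\<^sup>2 * (norm e)\<^sup>2 - 1/4 * (norm (p - y))\<^sup>2 \<le> a' * (s' * B1 + s'/s * B2)"
  proof -
    have "0 \<le> (norm (r *\<^sub>R e + (1/2) *\<^sub>R (p - y)))\<^sup>2"
      by simp
    also have "\<dots> = r\<^sup>2 * (norm e)\<^sup>2 + r * inner e (p - y) + 1/4 * (norm (p - y))\<^sup>2"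
      unfolding power2_norm_eq_inner
      by (simp add: inner_add_left inner_add_right inner_commute power2_eq_square)
    finally have "- r\<^sup>2 * (norm e)\<^sup>2 - 1/4 * (norm (p - y))\<^sup>2 \<le> r * inner e (p - y)"
      by simp
    also have "inner e (p - y) \<le> a * (s * B1 + B2)"
      using y_step[OF D(2)] unfolding e_y B1_def B2_def by (simp add: distrib_left)
    then have "r * inner e (p - y) \<le> r * (a * (s * B1 + B2))"
      using pos by (intro mult_left_mono) (auto simp: r_def)
    also have "\<dots> = a' * (s' * B1 + s'/s * B2)"
      using pos by (simp add: r_def field_simps)
    finally show ?thesis .
  qed

  (* The tangent of f2 at p, taken at y, costs the inner product that defines the curvature estimate. *)
  have B2: "\<Phi>2 p - \<Phi>2 y - \<l>2 * (norm (p - y))\<^sup>2 \<le> B2"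
    using tangent2[of p y] curv_est_mult_norm[of f2 y p]
    by (simp add: \<Phi>2_def B2_def \<l>2_def inner_diff_left inner_diff_right norm_minus_commute)
  (* c is the weight of the lower-level increment in the new step beyond its weight in the
     rescaled old step; it is nonnegative because the weights s decrease. *)
  define c where "c = a' * (1 - s'/s)"
  have c: "0 \<le> c" "s' * a' * (1/s' - 1/s) = c"
    using pos mono by (auto simp: c_def field_simps)
  have surplus: "c * (\<Phi>2 p - \<Phi>2 y - \<l>2 * (norm (p - y))\<^sup>2) \<le> c * B2"
    using B2 c(1) by (rule mult_left_mono)

  (* The step to p against z: the inner product becomes a difference of squared distances. *)
  have three_point: "1/2 * (norm (p - y))\<^sup>2 + 1/2 * (norm (p - z))\<^sup>2 - 1/2 * (norm (y - z))\<^sup>2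
      + a' * (s' * (\<Phi>1 y - \<Phi>1 z) + (\<Phi>2 y - \<Phi>2 z)) + a' * (s' * B1 + B2) \<le> 0"
  proof -
    have "inner (y - a' *\<^sub>R grad (f_comb f1 f2 s') y - p) (z - p)
        = 1/2 * (norm (p - y))\<^sup>2 + 1/2 * (norm (p - z))\<^sup>2 - 1/2 * (norm (y - z))\<^sup>2
          - a' * inner (grad (f_comb f1 f2 s') y) (z - y)
          + a' * inner (grad (f_comb f1 f2 s') y) (p - y)"
      unfolding power2_norm_eq_inner
      by (simp add: inner_diff_left inner_diff_right inner_commute algebra_simps)
    moreover have "a' * inner (grad (f_comb f1 f2 s') y) (z - y)
        \<le> a' * (s' * (f1 z - f1 y) + (f2 z - f2 y))"
      using tangent1[of y z] tangent2[of y z] pos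
      by (auto simp: G inner_add_left intro!: mult_left_mono add_mono)
    ultimately show ?thesis
      using p_step[OF D(3)]
      by (simp add: \<Phi>1_def \<Phi>2_def B1_def B2_def G inner_add_left algebra_simps)
  qed

  have split: "a' * (s' * B1 + B2) = a' * (s' * B1 + s'/s * B2) + c * B2"
    by (simp add: c_def algebra_simps)
  (* 1 - 2 a l + a^2 L^2 = (1 - a l) - (a l - a^2 L^2): the first part is absorbed by function
     values, the second one remains in the estimate. *)
  have "r\<^sup>2 * (norm e)\<^sup>2 = r\<^sup>2 * ((norm (w - y))\<^sup>2 * (1 - a * \<l>))
      - r\<^sup>2 * (a * \<l> - a\<^sup>2 * L\<^sup>2) * (norm (w - y))\<^sup>2"
    unfolding e_def forward_residual_norm \<l>_def L_def by (simp add: algebra_simps)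
  also have "r\<^sup>2 * ((norm (w - y))\<^sup>2 * (1 - a * \<l>))
      \<le> r\<^sup>2 * (a * (s * (\<Phi>1 w - \<Phi>1 y) + (\<Phi>2 w - \<Phi>2 y)))"
    using backward by (rule mult_left_mono) simp
  finally have "r\<^sup>2 * (norm e)\<^sup>2 \<le> r\<^sup>2 * a * (s * (\<Phi>1 w - \<Phi>1 y) + (\<Phi>2 w - \<Phi>2 y))
      - r\<^sup>2 * (a * \<l> - a\<^sup>2 * L\<^sup>2) * (norm (w - y))\<^sup>2"
    by (simp add: mult.assoc)
  with three_point forward surplus split
  have "1/2 * (norm (p - z))\<^sup>2 + (1/4 * (norm (p - y))\<^sup>2 - c * (\<l>2 * (norm (p - y))\<^sup>2))
      + c * (\<Phi>2 p - \<Phi>2 y) + a' * (s' * (\<Phi>1 y - \<Phi>1 z) + (\<Phi>2 y - \<Phi>2 z))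
    \<le> 1/2 * (norm (y - z))\<^sup>2 - r\<^sup>2 * (a * \<l> - a\<^sup>2 * L\<^sup>2) * (norm (w - y))\<^sup>2
      + r\<^sup>2 * a * (s * (\<Phi>1 w - \<Phi>1 y) + (\<Phi>2 w - \<Phi>2 y))"
    by (simp add: right_diff_distrib)
  moreover have "(1/4 - s' * a' * \<l>2 * (1/s' - 1/s)) * (norm (p - y))\<^sup>2
      = 1/4 * (norm (p - y))\<^sup>2 - c * (\<l>2 * (norm (p - y))\<^sup>2)"
    unfolding c(2)[symmetric] by (simp add: algebra_simps)
  ultimately show ?thesis
    unfolding c(2) by simp
qed

section \<open>Descent of the Lyapunov function\<close>

theorem lemma3p3:
  fixes f1 f2 :: "real ^ 'n \<Rightarrow> real"
    and g1 g2 :: "real ^ 'n \<Rightarrow> ereal"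
    and \<sigma> \<alpha> :: "int \<Rightarrow> real"
    and x :: "int \<Rightarrow> real ^ 'n"
    and xs :: "real ^ 'n"
    and k :: int
  defines "\<phi>1 \<equiv> cost f1 g1"
    and "\<phi>2bar \<equiv> (\<lambda>w. cost f2 g2 w - (INF z. cost f2 g2 z))"
    and "\<phi>star \<equiv> (INF z\<in>lower_sols f2 g2. cost f1 g1 z)"
    and "\<Delta> \<equiv> (\<lambda>j. 1 / \<sigma> j - 1 / \<sigma> (j - 1))"
    and "\<rho> \<equiv> (\<lambda>j. (\<sigma> j * \<alpha> j) / (\<sigma> (j - 1) * \<alpha> (j - 1)))"
    and "\<l> \<equiv> (\<lambda>j. curv_est (f_comb f1 f2 (\<sigma> j)) (x (j - 1)) (x j))"
    and "L \<equiv> (\<lambda>j. Lip_est (f_comb f1 f2 (\<sigma> j)) (x (j - 1)) (x j))"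
    and "\<l>2 \<equiv> (\<lambda>j. curv_est f2 (x (j - 1)) (x j))"
  defines "W \<equiv> (\<lambda>j.
      ereal ((1 - 4 * \<alpha> j * \<sigma> j * \<l>2 j * \<Delta> j) / 4 * (norm (x j - x (j - 1)))\<^sup>2)
      + ereal (\<sigma> (j + 1) / \<sigma> j * \<alpha> (j + 1) * \<rho> (j + 1)) * \<phi>2bar (x (j - 1))
      + ereal (\<sigma> j * \<alpha> j * \<Delta> j) * \<phi>2bar (x j)
      + ereal (\<sigma> j * \<alpha> j * (1 + \<rho> j)) * (\<phi>1 (x (j - 1)) - \<phi>star))"
  defines "\<L> \<equiv> (\<lambda>j z. ereal (1 / 2 * (norm (x j - z))\<^sup>2) + W j)"
  assumes "basic_assumption f1 f2 g1 g2"
    and "prox_grad_iterates f1 f2 g1 g2 \<sigma> \<alpha> x"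
    and "k \<ge> 0"
    and "xs \<in> bilevel_sols f1 f2 g1 g2"
  shows "\<L> (k + 1) xs - \<L> k xs \<le>
      - ereal ((1 / 4 + (\<rho> (k + 1))\<^sup>2 * (\<alpha> k * \<l> k - (\<alpha> k)\<^sup>2 * (L k)\<^sup>2) - \<sigma> k * \<alpha> k * \<l>2 k * \<Delta> k)
               * (norm (x (k - 1) - x k))\<^sup>2)
      - ereal (\<sigma> k * \<alpha> k * (1 + \<rho> k - (\<rho> (k + 1))\<^sup>2)) * (\<phi>1 (x (k - 1)) - \<phi>star)
      - ereal (\<sigma> (k + 1) * \<alpha> (k + 1) *
               (\<Delta> k / \<rho> (k + 1)
                + 1 / \<sigma> k * (1 + \<rho> (k + 1) - (\<rho> (k + 2))\<^sup>2 * (\<sigma> k / \<sigma> (k + 1)))))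
        * \<phi>2bar (x k)"
proof -
  note ba = assms(11)[unfolded basic_assumption_def]
  have f1: "convex_on UNIV f1" "locally_Lipschitz_grad f1"
    and f2: "convex_on UNIV f2" "locally_Lipschitz_grad f2"
    and g1: "econvex g1" "g1 w \<noteq> -\<infinity>" and g2: "econvex g2" "g2 w \<noteq> -\<infinity>" for w
    using ba by (auto simp: proper_def)
  have pos: "0 < \<sigma> j" "0 < \<alpha> j" and mono: "\<sigma> (j + 1) \<le> \<sigma> j" if "j \<ge> -1" for j
    using assms(12) that by (auto simp: prox_grad_iterates_def)
  define \<gamma>1 where "\<gamma>1 = (\<lambda>w. real_of_ereal (g1 w))"
  define \<gamma>2 where "\<gamma>2 = (\<lambda>w. real_of_ereal (g2 w))"
  define D where "D = edom g1 \<inter> edom g2"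
  have fin: "g1 w = ereal (\<gamma>1 w)" "g2 w = ereal (\<gamma>2 w)" if "w \<in> D" for w
    using that g1(2)[of w] g2(2)[of w]
    by (cases "g1 w"; cases "g2 w"; auto simp: D_def edom_def \<gamma>1_def \<gamma>2_def)+

  have step: "x j \<in> D"
    "z \<in> D \<Longrightarrow> inner (x (j - 1) - \<alpha> j *\<^sub>R grad (f_comb f1 f2 (\<sigma> j)) (x (j - 1)) - x j) (z - x j)
      \<le> \<alpha> j * (\<sigma> j * (\<gamma>1 z - \<gamma>1 (x j)) + (\<gamma>2 z - \<gamma>2 (x j)))" if "j \<ge> 0" for j z
  proof -
    have "x (i + 1) \<in> prox (\<lambda>w. ereal (\<alpha> (i + 1)) * g_comb g1 g2 (\<sigma> (i + 1)) w)
        (x i - \<alpha> (i + 1) *\<^sub>R grad (f_comb f1 f2 (\<sigma> (i + 1))) (x i))" if "i \<ge> -1" for i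
      using assms(12) that by (simp add: prox_grad_iterates_def)
    from this[of "j - 1"] that
    have "x j \<in> prox (\<lambda>w. ereal (\<alpha> j) * g_comb g1 g2 (\<sigma> j) w)
        (x (j - 1) - \<alpha> j *\<^sub>R grad (f_comb f1 f2 (\<sigma> j)) (x (j - 1)))"
      by simp
    from prox_g_comb_subgradient[OF g1 g2 _ _ this, folded D_def \<gamma>1_def \<gamma>2_def] pos[of j] that
    show "x j \<in> D"
      "z \<in> D \<Longrightarrow> inner (x (j - 1) - \<alpha> j *\<^sub>R grad (f_comb f1 f2 (\<sigma> j)) (x (j - 1)) - x j) (z - x j)
      \<le> \<alpha> j * (\<sigma> j * (\<gamma>1 z - \<gamma>1 (x j)) + (\<gamma>2 z - \<gamma>2 (x j)))"
      by (auto simp: \<gamma>1_def \<gamma>2_def)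
  qed

  have upper: "(INF z\<in>lower_sols f2 g2. cost f1 g1 z) = cost f1 g1 xs" "cost f1 g1 xs < \<infinity>"
    and xs: "xs \<in> lower_sols f2 g2"
    using argmin_on_INF[OF assms(14)[unfolded bilevel_sols_def]] by auto
  have lower: "(INF z. cost f2 g2 z) = cost f2 g2 xs" "cost f2 g2 xs < \<infinity>"
    using argmin_on_INF[OF xs[unfolded lower_sols_def]] by auto
  have xs_D: "xs \<in> D"
    using upper(2) lower(2) by (auto simp: cost_def D_def edom_def)
  define \<Phi>1 where "\<Phi>1 = (\<lambda>w. f1 w + \<gamma>1 w)"
  define \<Phi>2 where "\<Phi>2 = (\<lambda>w. f2 w + \<gamma>2 w)"
  have star: "\<phi>star = ereal (\<Phi>1 xs)" and bar: "\<phi>2bar w = cost f2 g2 w - ereal (\<Phi>2 xs)" for w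
    unfolding \<phi>star_def \<phi>2bar_def upper(1) lower(1)
    using fin[OF xs_D] by (simp_all add: cost_def \<Phi>1_def \<Phi>2_def)
  have val1: "\<phi>1 w - \<phi>star = ereal (\<Phi>1 w - \<Phi>1 xs)" and val2: "\<phi>2bar w = ereal (\<Phi>2 w - \<Phi>2 xs)"
    if "w \<in> D" for w
    unfolding star bar by (simp_all add: \<phi>1_def cost_def fin[OF that] \<Phi>1_def \<Phi>2_def)

  define r where "r = \<rho> (k + 1)"
  have r: "r = (\<sigma> (k + 1) * \<alpha> (k + 1)) / (\<sigma> k * \<alpha> k)" and r_pos: "0 < r"
    using pos[of k] pos[of "k + 1"] assms(13) by (simp_all add: r_def \<rho>_def)
  have D: "x k \<in> D" "x (k + 1) \<in> D"
    using step(1) assms(13) by auto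
  have next_real: "\<L> (k + 1) xs = ereal (1/2 * (norm (x (k + 1) - xs))\<^sup>2
      + ((1 - 4 * \<alpha> (k + 1) * \<sigma> (k + 1) * \<l>2 (k + 1) * \<Delta> (k + 1)) / 4 * (norm (x (k + 1) - x k))\<^sup>2
      + \<sigma> (k + 2) / \<sigma> (k + 1) * \<alpha> (k + 2) * \<rho> (k + 2) * (\<Phi>2 (x k) - \<Phi>2 xs)
      + \<sigma> (k + 1) * \<alpha> (k + 1) * \<Delta> (k + 1) * (\<Phi>2 (x (k + 1)) - \<Phi>2 xs)
      + \<sigma> (k + 1) * \<alpha> (k + 1) * (1 + r) * (\<Phi>1 (x k) - \<Phi>1 xs)))"
    by (simp add: \<L>_def W_def val1[OF D(1)] val2[OF D(1)] val2[OF D(2)] r_def add.commute[of k 2])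
  have r_identities: "\<sigma> (k + 1) / \<sigma> k * \<alpha> (k + 1) * r = r\<^sup>2 * \<alpha> k"
    "\<sigma> (k + 1) * \<alpha> (k + 1) = r * (\<sigma> k * \<alpha> k)"
    "\<sigma> (k + 1) * \<alpha> (k + 1) * \<Delta> (k + 1) = \<alpha> (k + 1) - r * \<alpha> k"
    "\<sigma> (k + 2) / \<sigma> (k + 1) * \<alpha> (k + 2) * \<rho> (k + 2) = (\<rho> (k + 2))\<^sup>2 * \<alpha> (k + 1)"
    using pos[of k] pos[of "k + 1"] pos[of "k + 2"] assms(13)
    by (simp_all add: r \<rho>_def \<Delta>_def field_simps power2_eq_square)
  show ?thesis
  proof (cases "x (k - 1) \<in> D")
    case False
    (* A positive coefficient multiplies the infinite value, and no term is -\<infinity>. *)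
    define c2 where "c2 = \<sigma> (k + 1) / \<sigma> k * \<alpha> (k + 1) * \<rho> (k + 1)"
    define c1 where "c1 = \<sigma> k * \<alpha> k * (1 + \<rho> k)"
    have "0 < \<rho> k"
      using pos[of "k - 1"] pos[of k] assms(13) by (simp add: \<rho>_def)
    then have c: "0 < c2" "0 < c1"
      using pos[of k] pos[of "k + 1"] assms(13) r_pos by (simp_all add: c1_def c2_def r_def)
    have "ereal c2 * \<phi>2bar (x (k - 1)) = \<infinity> \<or> ereal c1 * (\<phi>1 (x (k - 1)) - \<phi>star) = \<infinity>"
      "ereal c2 * \<phi>2bar (x (k - 1)) \<noteq> -\<infinity>" "ereal c1 * (\<phi>1 (x (k - 1)) - \<phi>star) \<noteq> -\<infinity>"
      using False g1(2)[of "x (k - 1)"] g2(2)[of "x (k - 1)"] c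
      unfolding star bar \<phi>1_def
      by (cases "g1 (x (k - 1))"; cases "g2 (x (k - 1))"; auto simp: cost_def D_def edom_def)+
    then have "\<L> k xs = \<infinity>"
      unfolding \<L>_def W_def c1_def[symmetric] c2_def[symmetric] val2[OF D(1)]
      by (cases "ereal c2 * \<phi>2bar (x (k - 1))"; cases "ereal c1 * (\<phi>1 (x (k - 1)) - \<phi>star)") auto
    then show ?thesis
      by (simp add: next_real)
  next
    case True
    note val1 = val1[OF True] and val2 = val2[OF True] val2[OF D(1)]
    have cur_real: "\<L> k xs = ereal (1/2 * (norm (x k - xs))\<^sup>2
        + ((1 - 4 * \<alpha> k * \<sigma> k * \<l>2 k * \<Delta> k) / 4 * (norm (x k - x (k - 1)))\<^sup>2
        + \<sigma> (k + 1) / \<sigma> k * \<alpha> (k + 1) * r * (\<Phi>2 (x (k - 1)) - \<Phi>2 xs)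
        + \<sigma> k * \<alpha> k * \<Delta> k * (\<Phi>2 (x k) - \<Phi>2 xs)
        + \<sigma> k * \<alpha> k * (1 + \<rho> k) * (\<Phi>1 (x (k - 1)) - \<Phi>1 xs)))"
      by (simp add: \<L>_def W_def val1 val2 r_def)
    have k1: "0 \<le> k + 1" "-1 \<le> k" "-1 \<le> k + 1" using assms(13) by auto
    have estimate: "1/2 * (norm (x (k + 1) - xs))\<^sup>2
        + (1/4 - \<sigma> (k + 1) * \<alpha> (k + 1) * \<l>2 (k + 1) * \<Delta> (k + 1)) * (norm (x (k + 1) - x k))\<^sup>2
        + \<sigma> (k + 1) * \<alpha> (k + 1) * \<Delta> (k + 1) * (\<Phi>2 (x (k + 1)) - \<Phi>2 (x k))
        + \<alpha> (k + 1) * (\<sigma> (k + 1) * (\<Phi>1 (x k) - \<Phi>1 xs) + (\<Phi>2 (x k) - \<Phi>2 xs))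
      \<le> 1/2 * (norm (x k - xs))\<^sup>2 - r\<^sup>2 * (\<alpha> k * \<l> k - (\<alpha> k)\<^sup>2 * (L k)\<^sup>2) * (norm (x (k - 1) - x k))\<^sup>2
        + r\<^sup>2 * \<alpha> k * (\<sigma> k * (\<Phi>1 (x (k - 1)) - \<Phi>1 (x k)) + (\<Phi>2 (x (k - 1)) - \<Phi>2 (x k)))"
      using prox_grad_step_estimate[OF f1 f2 pos(2)[OF k1(2)] pos(2)[OF k1(3)] pos(1)[OF k1(2)]
          pos(1)[OF k1(3)] mono[OF k1(2)] step(2)[OF assms(13)] step(2)[OF k1(1), simplified]
          True D(2) xs_D]
      by (simp add: r \<Phi>1_def \<Phi>2_def \<l>_def L_def \<l>2_def \<Delta>_def)
    have coeff: "\<sigma> (k + 1) * \<alpha> (k + 1) * (\<Delta> k / r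
          + 1 / \<sigma> k * (1 + r - (\<rho> (k + 2))\<^sup>2 * (\<sigma> k / \<sigma> (k + 1))))
        = \<sigma> k * \<alpha> k * \<Delta> k + r * \<alpha> k * (1 + r) - (\<rho> (k + 2))\<^sup>2 * \<alpha> (k + 1)"
    proof -
      have "\<sigma> (k + 1) * \<alpha> (k + 1) * (\<Delta> k / r) = \<sigma> k * \<alpha> k * \<Delta> k"
        using r_pos by (simp add: r_identities(2))
      moreover have "\<sigma> (k + 1) * \<alpha> (k + 1) * (1 / \<sigma> k * (1 + r)) = r * \<alpha> k * (1 + r)"
        using pos[of k] assms(13) by (simp add: r_identities(2))
      moreover have "\<sigma> (k + 1) * \<alpha> (k + 1) * (1 / \<sigma> k * (u * (\<sigma> k / \<sigma> (k + 1)))) = u * \<alpha> (k + 1)" for u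
        using pos[of k] pos[of "k + 1"] assms(13) by simp
      ultimately show ?thesis
        by (simp only: distrib_left right_diff_distrib)
    qed
    have quarter: "(1 - 4 * \<alpha> j * \<sigma> j * \<l>2 j * \<Delta> j) / 4 = 1/4 - \<sigma> j * \<alpha> j * \<l>2 j * \<Delta> j" for j
      by simp
    have level: "\<sigma> (k + 1) * \<alpha> (k + 1) * \<Delta> (k + 1) * u = (\<alpha> (k + 1) - r * \<alpha> k) * u"
      "\<sigma> (k + 1) * \<alpha> (k + 1) * (1 + r) * u = (r + r\<^sup>2) * (\<sigma> k * \<alpha> k) * u"
      "\<alpha> (k + 1) * (\<sigma> (k + 1) * u + v) = r * (\<sigma> k * \<alpha> k) * u + \<alpha> (k + 1) * v" for u v
    proof -
      show "\<sigma> (k + 1) * \<alpha> (k + 1) * \<Delta> (k + 1) * u = (\<alpha> (k + 1) - r * \<alpha> k) * u"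
        by (simp only: r_identities(3))
      show "\<sigma> (k + 1) * \<alpha> (k + 1) * (1 + r) * u = (r + r\<^sup>2) * (\<sigma> k * \<alpha> k) * u"
        unfolding r_identities(2) by (simp add: algebra_simps power2_eq_square)
      show "\<alpha> (k + 1) * (\<sigma> (k + 1) * u + v) = r * (\<sigma> k * \<alpha> k) * u + \<alpha> (k + 1) * v"
        unfolding r_identities(2)[symmetric] by (simp add: algebra_simps)
    qed
    define E where "E = (\<lambda>w. \<Phi>1 w - \<Phi>1 xs)"
    define F where "F = (\<lambda>w. \<Phi>2 w - \<Phi>2 xs)"
    have diffs: "\<Phi>1 u - \<Phi>1 v = E u - E v" "\<Phi>2 u - \<Phi>2 v = F u - F v" "E xs = 0" "F xs = 0" for u v
      by (simp_all add: E_def F_def)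
    show ?thesis
      unfolding next_real cur_real val1 val2 r_def[symmetric] coeff
      using estimate
      unfolding r_identities(1,4) level quarter norm_minus_commute[of "x k" "x (k - 1)"] diffs
      by (simp add: algebra_simps power2_eq_square)
  qed
qed

end
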